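(* Let $f:\mathbb{R}^2\to\mathbb{R}$ be a $C^1$ function and let $K_1,K_2\subset\mathbb{R}$ be Cantor sets, where the convex hull of $K_i$ is $[A_i,B_i]$. Let $D=[A_1,B_1]\times[A_2,B_2]$ and assume $|\partial_xf|>0$ and $|\partial_yf|>0$ on $D$. If for every $(x,y)\in D$ $$\frac1{\tau(K_1)}\le\left|\frac{\partial_xf}{\partial_yf}\right|\le\tau(K_2),$$ then $f(K_1,K_2)=\{f(x,y):x\in K_1,y\in K_2\}$ is a finite union of closed intervals. Moreover, the number of closed intervals is at most $h_1+v_1+1$, where $$h_1=\sharp\Big\{O_x:\frac{B_2-A_2}{|O_x|}\le\max_{(x,y)\in D}\left|\frac{\partial_xf}{\partial_yf}\right|\Big\},\qquad v_1=\sharp\Big\{O_y:\frac{|O_y|}{B_1-A_1}\ge\min_{(x,y)\in D}\left|\frac{\partial_xf}{\partial_yf}\right|\Big\},$$ and $O_x$, $O_y$ range over the gaps of $K_1$ and of $K_2$, respectively.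
   Context: Thickness. Let $K\subset\mathbb{R}$ be a Cantor set with convex hull $I$. The gaps of $K$ are the bounded connected components of $\mathbb{R}\setminus K$; they are enumerated as $(O_n)_{n\ge1}$ with non-increasing lengths $|O_n|$ (ties ordered arbitrarily). For each $n$, let $I_n$ be the connected component of $I\setminus(O_1\cup\cdots\cup O_{n-1})$ containing $O_n$, and let $L_n,R_n$ be the left and right closed intervals of $I_n\setminus O_n$ (called bridges). Then $$\tau(K)=\inf_{n}\frac{\min\{|L_n|,|R_n|\}}{|O_n|}.$$ It is always assumed that there are infinitely many gaps and that $K$ has no isolated points. *)

theory Defs
  imports "HOL-Analysis.Analysis"
begin

definition C1_function :: "(real \<times> real \<Rightarrow> real) \<Rightarrow> bool" where
  "C1_function f \<longleftrightarrow>
     (\<exists>f' :: real \<times> real \<Rightarrow> (real \<times> real) \<Rightarrow>\<^sub>L real.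
        (\<forall>p. (f has_derivative blinfun_apply (f' p)) (at p)) \<and> continuous_on UNIV f')"

definition partial_x :: "(real \<times> real \<Rightarrow> real) \<Rightarrow> real \<times> real \<Rightarrow> real" where
  "partial_x f p = deriv (\<lambda>x. f (x, snd p)) (fst p)"

definition partial_y :: "(real \<times> real \<Rightarrow> real) \<Rightarrow> real \<times> real \<Rightarrow> real" where
  "partial_y f p = deriv (\<lambda>y. f (fst p, y)) (snd p)"

text \<open>Nonempty, compact, perfect and totally disconnected; the infinitude of the set of gaps
  follows from these conditions.\<close>

definition cantor_set :: "real set \<Rightarrow> bool" where
  "cantor_set K \<longleftrightarrow>
     K \<noteq> {} \<and> compact K \<and> (\<forall>x\<in>K. x islimpt K) \<and>
     (\<forall>C\<in>components K. \<exists>x. C = {x})"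

definition gaps :: "real set \<Rightarrow> real set set" where
  "gaps K = {U \<in> components (- K). bounded U}"

abbreviation len :: "real set \<Rightarrow> real" where
  "len U \<equiv> measure lborel U"

text \<open>Enumerations are indexed from \<open>0\<close>.\<close>

definition gap_enumeration :: "real set \<Rightarrow> (nat \<Rightarrow> real set) \<Rightarrow> bool" where
  "gap_enumeration K G \<longleftrightarrow>
     bij_betw G UNIV (gaps K) \<and> (\<forall>m n. m \<le> n \<longrightarrow> len (G n) \<le> len (G m))"

definition parent_interval :: "real set \<Rightarrow> (nat \<Rightarrow> real set) \<Rightarrow> nat \<Rightarrow> real set" where
  "parent_interval K G n =
     (THE C. C \<in> components (convex hull K - (\<Union>i<n. G i)) \<and> G n \<subseteq> C)"

definition left_bridge :: "real set \<Rightarrow> (nat \<Rightarrow> real set) \<Rightarrow> nat \<Rightarrow> real set" where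
  "left_bridge K G n = {x \<in> parent_interval K G n. \<forall>u\<in>G n. x < u}"

definition right_bridge :: "real set \<Rightarrow> (nat \<Rightarrow> real set) \<Rightarrow> nat \<Rightarrow> real set" where
  "right_bridge K G n = {x \<in> parent_interval K G n. \<forall>u\<in>G n. u < x}"

text \<open>The value does not depend on how ties are ordered, so an arbitrary admissible enumeration
  is selected. It is a finite nonnegative number for every Cantor set; it is taken in
  \<^typ>\<open>ereal\<close> only in order that \<open>1 / thickness K = \<infinity>\<close> when the thickness is zero.\<close>

definition thickness :: "real set \<Rightarrow> ereal" where
  "thickness K =
     (let G = (SOME G. gap_enumeration K G) in
        INF n. ereal (min (len (left_bridge K G n)) (len (right_bridge K G n)) / len (G n)))"

end

theory Submission
  imports Defs
begin

text \<open>
  The image is computed by removing gaps from both sets one at a time, always the larger of the two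
  largest gaps that are still present. Write \<open>X\<^sub>n\<close> and \<open>Y\<^sub>m\<close> for the hulls of \<open>K1\<close> and \<open>K2\<close>
  after removal of the \<open>n\<close> respectively \<open>m\<close> longest gaps. These are finite unions of intervals that
  decrease to \<open>K1\<close> and \<open>K2\<close>, so by compactness it suffices to know how \<open>f ` (X\<^sub>n \<times> Y\<^sub>m)\<close> evolves.

  Let \<open>{l<..<r}\<close> be the gap to be removed from \<open>X\<^sub>n\<close> and let \<open>{c..d}\<close> be a component of \<open>Y\<^sub>m\<close>. The
  strip \<open>{l..r} \<times> {c..d}\<close> has the same image as its two vertical sides provided that
  \<open>\<bar>f\<^sub>x\<bar> * (r - l) \<le> \<bar>f\<^sub>y\<bar> * (d - c)\<close> (\<open>vertical_sides_cover_strip\<close>): by the mean value theorem on the two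
  diagonals the images of the sides are then intervals with a common point. In that case the removal does not
  change the image. If \<open>{c..d}\<close> is adjacent to a removed gap of \<open>K2\<close>, that gap is at least as
  long as \<open>r - l\<close>, by the order of removal, and the thickness bounds \<open>d - c\<close> below by \<open>\<tau>(K2)\<close> times
  its length (\<open>component_long\<close>); so the condition follows from \<open>\<bar>f\<^sub>x / f\<^sub>y\<bar> \<le> \<tau>(K2)\<close>. The removal of gaps of
  \<open>K2\<close> is the same situation after an exchange of the coordinates.

  The argument says nothing while \<open>Y\<^sub>m\<close> is still the whole hull of \<open>K2\<close> and the gap of \<open>K1\<close> is too
  long in comparison to it, or vice versa; all these gaps are among those counted by \<open>h1\<close> and \<open>v1\<close>. A gap of
  \<open>K1\<close> that is counted is longer than every gap of \<open>K2\<close>, and symmetrically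
  (\<open>oversized_gap_dominates\<close>), so the two numbers are not both positive. Hence all counted gaps may be
  removed at the start, which leaves \<open>(h1 + 1) * (v1 + 1) = h1 + v1 + 1\<close> rectangles at most, each
  with an interval as its image, and from then on the image is constant.
\<close>

section \<open>Gaps of compact sets of reals\<close>

text \<open>
  If an end point were outside \<open>K\<close>, the component could be enlarged by it.
\<close>

lemma gap_is_open_interval:
  fixes K :: "real set"
  assumes "closed K" and "U \<in> gaps K"
  obtains l r where "l < r" "U = {l<..<r}" "l \<in> K" "r \<in> K"
proof -
  have U: "U \<in> components (- K)" and bU: "bounded U"
    using assms(2) by (auto simp: gaps_def)
  have oU: "open U" using open_components[OF _ U] assms(1) by (simp add: open_Compl)
  have cU: "connected U" and neU: "U \<noteq> {}"
    using U by (auto intro: in_components_connected dest: in_components_nonempty)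
  have bounds: "bdd_above U" "bdd_below U"
    using bU by (auto intro: bounded_imp_bdd_above bounded_imp_bdd_below)
  define l r where "l = Inf U" and "r = Sup U"
  have "l \<notin> U"
  proof
    assume "l \<in> U"
    with oU obtain e where "e > 0" "ball l e \<subseteq> U" by (meson open_contains_ball)
    then have "l - e / 2 \<in> U" by (auto simp: subset_iff dist_real_def)
    then show False using cInf_lower[OF _ bounds(2), of "l - e/2"] \<open>e > 0\<close> by (simp add: l_def)
  qed
  have "r \<notin> U"
  proof
    assume "r \<in> U"
    with oU obtain e where "e > 0" "ball r e \<subseteq> U" by (meson open_contains_ball)
    then have "r + e / 2 \<in> U" by (auto simp: subset_iff dist_real_def)
    then show False using cSup_upper[OF _ bounds(1), of "r + e/2"] \<open>e > 0\<close> by (simp add: r_def)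
  qed
  have U_eq: "U = {l<..<r}"
  proof
    show "U \<subseteq> {l<..<r}"
    proof
      fix x assume "x \<in> U"
      then have "l \<le> x" "x \<le> r" using bounds by (auto simp: l_def r_def intro: cInf_lower cSup_upper)
      with \<open>x \<in> U\<close> \<open>l \<notin> U\<close> \<open>r \<notin> U\<close> show "x \<in> {l<..<r}" by (metis greaterThanLessThan_iff less_eq_real_def)
    qed
    show "{l<..<r} \<subseteq> U"
    proof
      fix x assume "x \<in> {l<..<r}"
      then obtain a b where "a \<in> U" "a < x" "b \<in> U" "x < b"
        using neU bounds unfolding l_def r_def
        by (metis cInf_less_iff less_cSup_iff greaterThanLessThan_iff)
      then show "x \<in> U" using connectedD_interval[OF cU, of a b x] by simp
    qed
  qed
  have lr: "l < r" using neU U_eq by auto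
  have end_in: "e \<in> K" if "e \<in> closure U" "e \<notin> U" for e
  proof (rule ccontr)
    assume "e \<notin> K"
    have "connected (insert e U)"
      by (rule connected_intermediate_closure[OF cU]) (use that closure_subset in auto)
    moreover have "insert e U \<subseteq> - K" using \<open>e \<notin> K\<close> in_components_subset[OF U] by auto
    ultimately have "insert e U \<subseteq> U"
      using components_maximal[OF U, of "insert e U"] neU by auto
    with that show False by auto
  qed
  have "closure U = {l..r}" using U_eq lr by simp
  then have "l \<in> K" "r \<in> K" using end_in \<open>l \<notin> U\<close> \<open>r \<notin> U\<close> lr by auto
  with lr U_eq that show thesis by blast
qed

lemma gaps_disjoint: "U \<in> gaps K \<Longrightarrow> V \<in> gaps K \<Longrightarrow> U \<noteq> V \<Longrightarrow> U \<inter> V = {}"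
  using components_nonoverlap[of U "- K" V] by (auto simp: gaps_def)

lemma gap_subset_hull:
  fixes K :: "real set"
  assumes "closed K" "U \<in> gaps K"
  shows "closure U \<subseteq> convex hull K"
proof -
  obtain l r where lr: "l < r" "U = {l<..<r}" "l \<in> K" "r \<in> K"
    using gap_is_open_interval[OF assms] .
  have "closed_segment l r \<subseteq> convex hull K"
    using lr by (intro closed_segment_subset) (auto intro: hull_inc)
  then show ?thesis using lr by (simp add: closed_segment_eq_real_ivl)
qed

lemma len_gap_pos:
  fixes K :: "real set"
  assumes "closed K" "U \<in> gaps K"
  shows "len U > 0"
  using gap_is_open_interval[OF assms] by (metis less_eq_real_def measure_lborel_Ioo diff_gt_0_iff_gt)

lemma hull_minus_gaps:
  fixes K :: "real set"
  assumes "compact K" "convex hull K = {A..B}"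
  shows "{A..B} - \<Union>(gaps K) = K"
proof
  show "K \<subseteq> {A..B} - \<Union>(gaps K)"
    using assms hull_subset[of K convex] in_components_subset by (fastforce simp: gaps_def)
  show "{A..B} - \<Union>(gaps K) \<subseteq> K"
  proof
    fix x assume x: "x \<in> {A..B} - \<Union>(gaps K)"
    show "x \<in> K"
    proof (rule ccontr)
      assume nx: "x \<notin> K"
      define U where "U = connected_component_set (- K) x"
      have U: "U \<in> components (- K)" "x \<in> U" using nx by (auto simp: U_def componentsI)
      have cU: "connected U" by (simp add: U_def)
      \<comment> \<open>A point of the hull has points of the set on both sides, and these confine the component.\<close>
      have "\<exists>a\<in>K. a \<le> x" "\<exists>b\<in>K. x \<le> b"
      proof -
        have neg: False if "K \<subseteq> {x<..} \<or> K \<subseteq> {..<x}"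
        proof -
          have "convex hull K \<subseteq> {x<..} \<or> convex hull K \<subseteq> {..<x}"
            using that hull_minimal[of K "{x<..}" convex] hull_minimal[of K "{..<x}" convex] by auto
          with x assms(2) show False by auto
        qed
        then show "\<exists>a\<in>K. a \<le> x" "\<exists>b\<in>K. x \<le> b" by (auto simp: subset_iff not_le[symmetric])
      qed
      then obtain a b where ab: "a \<in> K" "a \<le> x" "b \<in> K" "x \<le> b" by blast
      have "U \<subseteq> {a..b}"
      proof
        fix u assume u: "u \<in> U"
        have "a \<notin> U" "b \<notin> U" using ab in_components_subset[OF U(1)] by auto
        then show "u \<in> {a..b}"
          using connectedD_interval[OF cU u U(2), of a] connectedD_interval[OF cU U(2) u, of b] ab by force
      qed
      then have "U \<in> gaps K" using U bounded_subset[of "{a..b}" U] by (auto simp: gaps_def)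
      with x U show False by auto
    qed
  qed
qed

text \<open>
  Disjoint intervals inside the hull have total length at most that of the hull.
\<close>

lemma finite_large_gaps:
  fixes K :: "real set"
  assumes "compact K" "e > 0"
  shows "finite {U \<in> gaps K. e \<le> len U}"
proof -
  obtain A B where AB: "convex hull K = {A..B}"
    using connected_compact_interval_1[of "convex hull K"] compact_convex_hull[OF assms(1)]
      convex_connected[OF convex_convex_hull[of K]] by blast
  have clK: "closed K" using assms(1) by (rule compact_imp_closed)
  show ?thesis
  proof (rule conjunct1[OF finite_if_finite_subsets_card_bdd])
    show "card F \<le> nat \<lfloor>len {A..B} / e\<rfloor>"
      if F: "F \<subseteq> {U \<in> gaps K. e \<le> len U}" "finite F" for F
    proof -
      have sub: "U \<subseteq> {A..B}" if "U \<in> F" for U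
        using that F gap_subset_hull[OF clK, of U] closure_subset[of U] AB by blast
      have meas: "U \<in> fmeasurable lborel" if "U \<in> F" for U
        using gap_is_open_interval[OF clK, of U] that F(1)
        by (metis (no_types, lifting) fmeasurableI emeasure_lborel_Ioo ennreal_less_top less_eq_real_def
            mem_Collect_eq sets_lborel subset_iff borel_open open_greaterThanLessThan infinity_ennreal_def)
      have "real (card F) * e = (\<Sum>U\<in>F. e)" by simp
      also have "\<dots> \<le> (\<Sum>U\<in>F. len U)" using F by (intro sum_mono) auto
      also have "\<dots> = len (\<Union>F)"
      proof -
        have "disjoint F" using F gaps_disjoint[of _ K] by (auto simp: disjoint_def subset_iff)
        then show ?thesis using measure_Union'[OF F(2)] meas by (simp add: disjoint_def pairwise_def disjnt_def)
      qed
      also have "\<dots> \<le> len {A..B}"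
      proof (rule measure_mono_fmeasurable)
        show "\<Union>F \<in> sets lborel" using fmeasurableD[OF meas] F(2) by blast
        show "{A..B} \<in> fmeasurable lborel" by (rule fmeasurableI) (auto simp: emeasure_lborel_Icc_eq)
      qed (use sub in blast)
      finally have "real (card F) \<le> len {A..B} / e" using assms(2) by (simp add: field_simps)
      then show "card F \<le> nat \<lfloor>len {A..B} / e\<rfloor>" by (simp add: le_nat_floor)
    qed
  qed
qed

text \<open>
  Otherwise the interval \<open>{x..y}\<close> would lie in a single component of \<open>K\<close>.
\<close>

lemma gap_between:
  fixes K :: "real set"
  assumes K: "\<forall>C\<in>components K. \<exists>x. C = {x}" and "x \<in> K" "y \<in> K" "x < y"
  shows "\<exists>U\<in>gaps K. U \<subseteq> {x<..<y}"
proof -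
  have "\<not> {x..y} \<subseteq> K"
  proof
    assume sub: "{x..y} \<subseteq> K"
    then have "{x..y} \<subseteq> connected_component_set K x"
      using assms by (intro connected_component_maximal) auto
    moreover have "connected_component_set K x \<in> components K" using assms by (auto intro: componentsI)
    ultimately show False using K \<open>x < y\<close>
      by (metis atLeastAtMost_iff less_eq_real_def less_irrefl order_refl singletonD subsetD)
  qed
  then obtain z where z: "z \<in> {x..y}" "z \<notin> K" by blast
  define U where "U = connected_component_set (- K) z"
  have U: "U \<in> components (- K)" "z \<in> U" using z by (auto simp: U_def componentsI)
  have cU: "connected U" by (simp add: U_def)
  have notin: "x \<notin> U" "y \<notin> U" using assms in_components_subset[OF U(1)] by auto
  have sub: "U \<subseteq> {x<..<y}"
  proof
    fix u assume u: "u \<in> U"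
    show "u \<in> {x<..<y}"
      using connectedD_interval[OF cU u U(2), of x] connectedD_interval[OF cU U(2) u, of y] notin z(1) u
      by (force simp: not_less not_le)
  qed
  then have "U \<in> gaps K" using U bounded_subset[of "{x<..<y}" U] by (auto simp: gaps_def)
  with sub show ?thesis by blast
qed

text \<open>
  Arbitrarily close points of \<open>K\<close> exist because there are no isolated points, and the gap
  between two of them is shorter than their distance. So the lengths have no positive minimum.
\<close>

lemma infinite_gaps:
  assumes "cantor_set K"
  shows "infinite (gaps K)"
proof
  assume fin: "finite (gaps K)"
  have K: "compact K" "\<forall>C\<in>components K. \<exists>x. C = {x}" "\<forall>x\<in>K. x islimpt K" "K \<noteq> {}"
    using assms by (auto simp: cantor_set_def)
  have clK: "closed K" using K(1) by (rule compact_imp_closed)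
  obtain d where d: "d > 0" "\<And>U. U \<in> gaps K \<Longrightarrow> d \<le> len U"
  proof (cases "gaps K = {}")
    case True then show thesis using that[of 1] by auto
  next
    case False
    then show thesis
      using that[of "Min (len ` gaps K)"] fin len_gap_pos[OF clK] by (auto simp: Min_gr_iff)
  qed
  obtain p where p: "p \<in> K" using K(4) by auto
  then obtain q where q: "q \<in> K" "q \<noteq> p" "dist q p < d"
    using K(3) d(1) by (meson islimpt_approachable)
  define x y where "x = min p q" and "y = max p q"
  have xy: "x \<in> K" "y \<in> K" "x < y" "y - x < d"
    using p q by (auto simp: x_def y_def min_def max_def dist_real_def)
  obtain U where U: "U \<in> gaps K" "U \<subseteq> {x<..<y}" using gap_between[OF K(2) xy(1-3)] by blast
  obtain l r where lr: "l < r" "U = {l<..<r}" using gap_is_open_interval[OF clK U(1)] by metis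
  have "x \<le> l" "r \<le> y" using U(2) lr by (auto simp: greaterThanLessThan_subseteq_greaterThanLessThan)
  then have "len U < d" using lr xy by simp
  with d(2)[OF U(1)] show False by simp
qed

text \<open>
  Choose repeatedly a longest gap among those not yet chosen; one exists because only finitely many
  exceed a given length. A gap that was never chosen would be no longer than each of the infinitely many
  chosen ones, so none is left out.
\<close>

lemma gap_enumeration_exists:
  assumes "cantor_set K"
  shows "\<exists>G. gap_enumeration K G"
proof -
  have cK: "compact K" and clK: "closed K" using assms by (auto simp: cantor_set_def compact_imp_closed)
  have inf: "infinite (gaps K)" using assms by (rule infinite_gaps)
  \<comment> \<open>\<open>best S U\<close>: the gap \<open>U\<close> is a longest one outside \<open>S\<close>.\<close>
  define best where "best S U \<longleftrightarrow> U \<in> gaps K - S \<and> (\<forall>V\<in>gaps K - S. len V \<le> len U)" for S U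
  have best_ex: "\<exists>U. best S U" if S: "finite S" for S
  proof -
    obtain U0 where U0: "U0 \<in> gaps K - S"
      using infinite_imp_nonempty[OF Diff_infinite_finite[OF S inf]] by blast
    define T where "T = {U \<in> gaps K. len U0 \<le> len U} - S"
    have T: "finite T" "U0 \<in> T"
      using finite_large_gaps[OF cK len_gap_pos[OF clK, of U0]] U0 by (auto simp: T_def)
    obtain U where U: "U \<in> T" "\<And>V. V \<in> T \<Longrightarrow> len V \<le> len U"
      using T obtains_MAX[of T len] by (metis Max_ge empty_iff finite_imageI image_eqI)
    have "len V \<le> len U" if "V \<in> gaps K - S" for V
      using U(2)[of V] U(2)[OF T(2)] that by (cases "len U0 \<le> len V") (auto simp: T_def)
    with U(1) show ?thesis by (auto simp: best_def T_def)
  qed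
  define next_gap where "next_gap S = (SOME U. best S U)" for S
  define removed where "removed = rec_nat {} (\<lambda>n S. insert (next_gap S) S)"
  define G where "G n = next_gap (removed n)" for n
  have removed: "removed n = G ` {..<n}" for n
    by (induction n) (auto simp: removed_def G_def lessThan_Suc)
  have G: "best (G ` {..<n}) (G n)" for n
  proof -
    have "best (G ` {..<n}) (next_gap (G ` {..<n}))"
      unfolding next_gap_def by (rule someI_ex[OF best_ex]) simp
    then show ?thesis by (simp only: G_def[of n] removed)
  qed
  have inj: "inj G"
  proof (rule linorder_injI)
    fix m n :: nat assume "m < n"
    then show "G m \<noteq> G n" using G[of n] by (auto simp: best_def)
  qed
  have anti: "len (G n) \<le> len (G m)" if "m \<le> n" for m n
  proof -
    have "G n \<in> gaps K - G ` {..<m}" using G[of n] that by (fastforce simp: best_def)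
    then show ?thesis using G[of m] by (simp add: best_def)
  qed
  have "U \<in> range G" if U: "U \<in> gaps K" for U
  proof (rule ccontr)
    assume "U \<notin> range G"
    then have "range G \<subseteq> {V \<in> gaps K. len U \<le> len V}" 
    proof (intro image_subsetI CollectI conjI)
      fix n
      show "G n \<in> gaps K" "len U \<le> len (G n)"
        using G[of n] U \<open>U \<notin> range G\<close> by (auto simp: best_def)
    qed
    then have "finite (range G)"
      using finite_large_gaps[OF cK len_gap_pos[OF clK U]] finite_subset by blast
    then show False using inj finite_imageD by blast
  qed
  moreover have "range G \<subseteq> gaps K" using G by (auto simp: best_def)
  ultimately have "bij_betw G UNIV (gaps K)" using inj by (auto simp: bij_betw_def)
  with anti show ?thesis by (auto simp: gap_enumeration_def)
qed

section \<open>Removing the gaps in order of length\<close>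

locale gap_sequence =
  fixes K :: "real set" and G :: "nat \<Rightarrow> real set" and A B :: real
  assumes compact_K: "compact K"
    and hull_K: "convex hull K = {A..B}"
    and enumeration: "gap_enumeration K G"
begin

text \<open>
  What is left of the hull after removal of the \<open>n\<close> longest gaps.
\<close>

definition stage :: "nat \<Rightarrow> real set" where
  "stage n = {A..B} - (\<Union>i<n. G i)"

lemma closed_K: "closed K"
  using compact_K by (rule compact_imp_closed)

lemma gap_in_gaps: "G n \<in> gaps K"
  using enumeration by (auto simp: gap_enumeration_def bij_betw_def)

lemma range_gaps: "range G = gaps K"
  using enumeration by (auto simp: gap_enumeration_def bij_betw_def)

lemma inj_gaps: "inj G"
  using enumeration by (auto simp: gap_enumeration_def bij_betw_def)

lemma len_gap_antimono: "m \<le> n \<Longrightarrow> len (G n) \<le> len (G m)"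
  using enumeration by (auto simp: gap_enumeration_def)

lemma len_gap_positive: "len (G n) > 0"
  using len_gap_pos[OF closed_K gap_in_gaps] .

lemma stage_Suc: "stage (Suc n) = stage n - G n"
  by (auto simp: stage_def lessThan_Suc)

lemma stage_antimono: "m \<le> n \<Longrightarrow> stage n \<subseteq> stage m"
  by (auto simp: stage_def)

lemma stage_subset_hull: "stage n \<subseteq> {A..B}"
  by (auto simp: stage_def)

lemma compact_stage: "compact (stage n)"
proof -
  have "open (G i)" for i
    using gap_is_open_interval[OF closed_K gap_in_gaps] by (metis open_greaterThanLessThan)
  then show ?thesis unfolding stage_def by (intro compact_diff) auto
qed

lemma K_subset_stage: "K \<subseteq> stage n"
proof
  fix x assume "x \<in> K"
  then have "x \<in> {A..B} - \<Union>(gaps K)" using hull_minus_gaps[OF compact_K hull_K] by simp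
  then show "x \<in> stage n" using gap_in_gaps by (auto simp: stage_def)
qed

lemma Inter_stage: "(\<Inter>n. stage n) = K"
proof
  show "(\<Inter>n. stage n) \<subseteq> K"
  proof
    fix x assume "x \<in> (\<Inter>n. stage n)"
    then have "x \<in> {A..B}" "x \<notin> G i" for i by (auto simp: stage_def)
    then have "x \<in> {A..B} - \<Union>(gaps K)" using range_gaps by auto
    then show "x \<in> K" using hull_minus_gaps[OF compact_K hull_K] by simp
  qed
qed (use K_subset_stage in blast)

lemma ex_gap_shorter_than:
  assumes "e > 0"
  shows "\<exists>M. len (G M) < e"
proof (rule ccontr)
  assume "\<nexists>M. len (G M) < e"
  then have "range G \<subseteq> {U \<in> gaps K. e \<le> len U}" using gap_in_gaps by (auto simp: not_less)
  then have "finite (range G)" using finite_large_gaps[OF compact_K assms] finite_subset by blast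
  then show False using inj_gaps finite_imageD by blast
qed

lemma gap_ends:
  obtains l r where "l < r" "G n = {l<..<r}" "l \<in> K" "r \<in> K" "{l..r} \<subseteq> stage n"
proof -
  obtain l r where lr: "l < r" "G n = {l<..<r}" "l \<in> K" "r \<in> K"
    using gap_is_open_interval[OF closed_K gap_in_gaps] .
  have "{l<..<r} \<subseteq> stage n"
  proof -
    have "G n \<inter> G i = {}" if "i < n" for i
      using gaps_disjoint[OF gap_in_gaps gap_in_gaps] inj_gaps that by (metis inj_eq nat_neq_iff)
    moreover have "G n \<subseteq> {A..B}"
      using gap_subset_hull[OF closed_K gap_in_gaps] hull_K closure_subset by blast
    ultimately show ?thesis using lr by (fastforce simp: stage_def)
  qed
  moreover have "l \<in> stage n" "r \<in> stage n" using K_subset_stage lr by auto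
  ultimately have "{l..r} \<subseteq> stage n" by (auto simp: subset_iff less_eq_real_def)
  with lr that show thesis by blast
qed

lemma stage_component_interval:
  assumes "C \<in> components (stage n)"
  obtains a b where "C = {a..b}" "a \<le> b"
proof -
  have "connected C" "compact C" "C \<noteq> {}"
    using assms compact_stage in_components_connected in_components_nonempty compact_components by blast+
  then show thesis using that connected_compact_interval_1[of C] by auto
qed

text \<open>
  A gap lies in one component of the set that remains after removal of the longer ones. This component
  is the parent interval, and its removal replaces it by the two bridges and leaves the others as they are.
  The inclusion in the last clause suffices to bound the lengths and the number of components.
\<close>

lemma gap_splits_component:
  obtains a l r b where
    "a \<le> l" "l < r" "r \<le> b" "G n = {l<..<r}" "{a..b} \<in> components (stage n)"
    "left_bridge K G n = {a..l}" "right_bridge K G n = {r..b}"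
    "components (stage (Suc n)) \<subseteq> {{a..l}, {r..b}} \<union> (components (stage n) - {{a..b}})"
proof -
  obtain l r where lr: "l < r" "G n = {l<..<r}" "l \<in> K" "r \<in> K" "{l..r} \<subseteq> stage n"
    by (rule gap_ends)
  then obtain C where C: "C \<in> components (stage n)" "{l..r} \<subseteq> C"
    using exists_component_superset[of "{l..r}" "stage n"] by fastforce
  obtain a b where ab: "C = {a..b}" "a \<le> b" using stage_component_interval[OF C(1)] .
  have al: "a \<le> l" and rb: "r \<le> b" using C(2) lr(1) ab by auto
  have unique: "E = C" if "E \<in> components (stage n)" "E \<inter> G n \<noteq> {}" for E
    using components_nonoverlap[OF that(1) C(1)] that(2) C(2) lr(2) by fastforce
  have "parent_interval K G n = {a..b}"
    unfolding parent_interval_def hull_K stage_def[symmetric]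
  proof (rule the_equality)
    show "{a..b} \<in> components (stage n) \<and> G n \<subseteq> {a..b}" using C ab lr(2) by auto
    show "E = {a..b}" if E: "E \<in> components (stage n) \<and> G n \<subseteq> E" for E
    proof -
      have "G n \<noteq> {}" using lr(1,2) by simp
      then show ?thesis using unique[of E] E ab(1) by blast
    qed
  qed
  moreover have "(\<forall>u\<in>G n. x < u) \<longleftrightarrow> x \<le> l" for x
  proof
    assume less: "\<forall>u\<in>G n. x < u"
    show "x \<le> l"
    proof (rule ccontr)
      assume "\<not> x \<le> l"
      then obtain u where "l < u" "u < min x r" using dense[of l "min x r"] lr(1) by auto
      with less lr(2) show False by fastforce
    qed
  qed (use lr(2) in auto)
  moreover have "(\<forall>u\<in>G n. u < x) \<longleftrightarrow> r \<le> x" for x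
  proof
    assume less: "\<forall>u\<in>G n. u < x"
    show "r \<le> x"
    proof (rule ccontr)
      assume "\<not> r \<le> x"
      then obtain u where "max x l < u" "u < r" using dense[of "max x l" r] lr(1) by auto
      with less lr(2) show False by fastforce
    qed
  qed (use lr(2) in auto)
  ultimately have bridges: "left_bridge K G n = {a..l}" "right_bridge K G n = {r..b}"
    using al rb lr(1) by (auto simp: left_bridge_def right_bridge_def)
  have "D \<in> {{a..l}, {r..b}} \<union> (components (stage n) - {{a..b}})"
    if D: "D \<in> components (stage (Suc n))" for D
  proof -
    have Dsub: "D \<subseteq> stage n" "D \<inter> G n = {}" "D \<noteq> {}" "connected D"
      using in_components_subset[OF D] in_components_nonempty[OF D] in_components_connected[OF D]
      by (auto simp: stage_Suc)
    have stages: "C \<subseteq> stage n" using in_components_subset[OF C(1)] .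
    obtain E where E: "E \<in> components (stage n)" "D \<subseteq> E"
      using exists_component_superset[OF Dsub(1)] Dsub by blast
    show ?thesis
    proof (cases "E = C")
      case False
      then have "E \<subseteq> stage (Suc n)"
        using unique[OF E(1)] in_components_subset[OF E(1)] by (auto simp: stage_Suc)
      then have "E \<subseteq> D"
        using components_maximal[OF D in_components_connected[OF E(1)]] E(2) Dsub(3) by blast
      with E False ab show ?thesis by auto
    next
      case True
      have "(l + r) / 2 \<notin> D" using Dsub(2) lr(1,2) by auto
      then have "D \<subseteq> {..l} \<or> D \<subseteq> {r..}"
        using connectedD_interval[OF Dsub(4), of _ _ "(l + r) / 2"] Dsub(2) lr(1,2)
        by (force simp: subset_iff not_le disjoint_iff)
      then have "D \<subseteq> {a..l} \<or> D \<subseteq> {r..b}" using E(2) True ab by fastforce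
      moreover have "{a..l} \<subseteq> stage (Suc n)" "{r..b} \<subseteq> stage (Suc n)"
        using stages ab lr(1,2) al rb by (auto simp: stage_Suc)
      then have "D \<subseteq> {a..l} \<Longrightarrow> {a..l} \<subseteq> D" "D \<subseteq> {r..b} \<Longrightarrow> {r..b} \<subseteq> D"
        using components_maximal[OF D, of "{a..l}"] components_maximal[OF D, of "{r..b}"] Dsub(3)
        by auto
      ultimately show ?thesis by auto
    qed
  qed
  with that al lr(1,2) rb C(1) ab bridges show thesis by blast
qed

lemma components_stage_0: "components (stage 0) = {{A..B}}"
proof -
  have "K \<noteq> {}" using gap_ends[of 0] by blast
  then have "{A..B} \<noteq> {}" using hull_K by force
  then show ?thesis by (auto simp: stage_def components_eq_sing_iff)
qed

lemma card_components_stage: "finite (components (stage n)) \<and> card (components (stage n)) \<le> n + 1"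
proof (induction n)
  case 0
  then show ?case by (simp add: components_stage_0)
next
  case (Suc n)
  obtain a l r b where C: "{a..b} \<in> components (stage n)"
    and sub: "components (stage (Suc n)) \<subseteq> {{a..l}, {r..b}} \<union> (components (stage n) - {{a..b}})"
    by (rule gap_splits_component)
  let ?S = "components (stage n) - {{a..b}}"
  have fin: "finite ({{a..l}, {r..b}} \<union> ?S)" using Suc by simp
  have "card ({{a..l}, {r..b}} \<union> ?S) \<le> card {{a..l}, {r..b}} + card ?S" by (rule card_Un_le)
  also have "\<dots> \<le> 2 + card ?S" by (simp add: card_insert_if)
  also have "\<dots> = 1 + card (components (stage n))"
    using card_Suc_Diff1[OF conjunct1[OF Suc] C] by simp
  also have "\<dots> \<le> Suc n + 1" using Suc by simp
  finally show ?case using card_mono[OF fin sub] finite_subset[OF sub fin] by simp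
qed

text \<open>
  The lengths are non-increasing, so the gaps of length at least \<open>c\<close> are the first ones of the enumeration.
\<close>

lemma large_gap_iff_index:
  assumes "c > 0"
  shows "c \<le> len (G n) \<longleftrightarrow> n < card {U \<in> gaps K. c \<le> len U}"
proof -
  define N where "N = {n. c \<le> len (G n)}"
  have im: "G ` N = {U \<in> gaps K. c \<le> len U}" unfolding N_def range_gaps[symmetric] by blast
  have inj: "inj_on G N" using inj_gaps by (rule inj_on_subset) simp
  have fin: "finite N" using finite_large_gaps[OF compact_K assms] im inj by (metis finite_imageD)
  have down: "m \<in> N" if "n \<in> N" "m \<le> n" for m n
    using that len_gap_antimono[of m n] by (auto simp: N_def)
  have "n < card N" if "n \<in> N" for n
  proof -
    have "{..n} \<subseteq> N" using down[OF that] by auto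
    then have "card {..n} \<le> card N" using fin by (rule card_mono[rotated])
    then show ?thesis by simp
  qed
  then have "N = {..<card N}" by (intro card_subset_eq) auto
  then have "n \<in> N \<longleftrightarrow> n < card N" by auto
  moreover have "card N = card {U \<in> gaps K. c \<le> len U}" using card_image[OF inj] im by simp
  ultimately show ?thesis by (simp add: N_def)
qed

end

locale thick_gap_sequence = gap_sequence +
  fixes t :: real
  assumes t_pos: "t > 0"
    and left_bridge_long: "t * len (G n) \<le> len (left_bridge K G n)"
    and right_bridge_long: "t * len (G n) \<le> len (right_bridge K G n)"
begin

text \<open>
  A bridge of the gap last removed has the required length by the hypothesis on bridges. Every other
  component was there before, and the gap removed before was at least as long.
\<close>

lemma component_long: "C \<in> components (stage (Suc n)) \<Longrightarrow> t * len (G n) \<le> len C"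
proof (induction n arbitrary: C)
  case (0 C)
  obtain a l r b where "{a..b} \<in> components (stage 0)"
    "left_bridge K G 0 = {a..l}" "right_bridge K G 0 = {r..b}"
    "components (stage (Suc 0)) \<subseteq> {{a..l}, {r..b}} \<union> (components (stage 0) - {{a..b}})"
    by (rule gap_splits_component)
  with 0 left_bridge_long[of 0] right_bridge_long[of 0] show ?case
    by (auto simp: components_stage_0)
next
  case (Suc n C)
  obtain a l r b where "left_bridge K G (Suc n) = {a..l}" "right_bridge K G (Suc n) = {r..b}"
    "components (stage (Suc (Suc n))) \<subseteq> {{a..l}, {r..b}} \<union> (components (stage (Suc n)) - {{a..b}})"
    by (rule gap_splits_component)
  then consider "C = left_bridge K G (Suc n)" | "C = right_bridge K G (Suc n)"
    | "C \<in> components (stage (Suc n))"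
    using Suc.prems by blast
  then show ?case
  proof cases
    case 3
    have "t * len (G (Suc n)) \<le> t * len (G n)"
      using t_pos len_gap_antimono[of n "Suc n"] by (intro mult_left_mono) auto
    with Suc.IH[OF 3] show ?thesis by simp
  qed (use left_bridge_long right_bridge_long in auto)
qed

lemma hull_longer_than_gap_and_bridges: "(2 * t + 1) * len (G 0) \<le> B - A"
proof -
  obtain a l r b where s: "a \<le> l" "l < r" "r \<le> b" "G 0 = {l<..<r}" "{a..b} \<in> components (stage 0)"
    "left_bridge K G 0 = {a..l}" "right_bridge K G 0 = {r..b}"
    by (rule gap_splits_component)
  then have "a = A" "b = B" by (auto simp: components_stage_0)
  with s left_bridge_long[of 0] right_bridge_long[of 0] show ?thesis by (simp add: algebra_simps)
qed

lemma hull_nondegenerate: "A < B"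
proof -
  have "0 < (2 * t + 1) * len (G 0)" using t_pos len_gap_positive by simp
  with hull_longer_than_gap_and_bridges show ?thesis by linarith
qed

lemma component_nondegenerate:
  assumes "C \<in> components (stage n)"
  obtains a b where "C = {a..b}" "a < b"
proof -
  obtain a b where ab: "C = {a..b}" "a \<le> b" using stage_component_interval[OF assms] .
  have "a < b"
  proof (cases n)
    case 0
    with assms ab hull_nondegenerate show ?thesis by (simp add: components_stage_0)
  next
    case (Suc m)
    have "0 < t * len (G m)" using t_pos len_gap_positive by simp
    with component_long[of C m] assms Suc ab show ?thesis by auto
  qed
  with ab that show thesis by blast
qed

end

section \<open>Thickness as a bound for the bridges\<close>

text \<open>
  The infimum is a real number because it lies between zero and the quotient of the longest gap. The
  enumeration is the one selected by the choice operator in the definition; the existence of an enumeration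
  makes it admissible.
\<close>

lemma thickness_bounds_bridges:
  assumes "cantor_set K" "convex hull K = {A..B}"
  obtains G t where "thickness K = ereal t" "0 \<le> t" "gap_enumeration K G"
    "\<forall>n. t * len (G n) \<le> len (left_bridge K G n)"
    "\<forall>n. t * len (G n) \<le> len (right_bridge K G n)"
proof -
  define G where "G = (SOME G. gap_enumeration K G)"
  have enum: "gap_enumeration K G"
    unfolding G_def using gap_enumeration_exists[OF assms(1)] by (rule someI_ex)
  interpret gap_sequence K G A B
    using assms(1) by unfold_locales (simp_all add: cantor_set_def assms(2) enum)
  let ?q = "\<lambda>n. min (len (left_bridge K G n)) (len (right_bridge K G n)) / len (G n)"
  have th: "thickness K = (INF n. ereal (?q n))" by (simp add: thickness_def G_def Let_def)
  have le: "thickness K \<le> ereal (?q n)" for n unfolding th by (rule INF_lower) simp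
  have "0 \<le> thickness K" unfolding th by (intro INF_greatest) (simp add: min_def)
  with le[of 0] obtain t where t: "thickness K = ereal t" "0 \<le> t" by (cases "thickness K") auto
  have "t * len (G n) \<le> min (len (left_bridge K G n)) (len (right_bridge K G n))" for n
    using le[of n] len_gap_positive[of n] by (simp only: t ereal_less_eq pos_le_divide_eq)
  with that[OF t enum] show thesis by simp
qed

section \<open>Maps with nonvanishing partial derivatives on a rectangle\<close>

lemma nonvanishing_constant_sign:
  fixes g :: "'a::topological_space \<Rightarrow> real"
  assumes "connected S" "continuous_on S g" "\<And>p. p \<in> S \<Longrightarrow> g p \<noteq> 0"
  shows "(\<forall>p\<in>S. g p > 0) \<or> (\<forall>p\<in>S. g p < 0)"
proof (rule ccontr)
  assume "\<not> ?thesis"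
  then obtain p q where pq: "p \<in> S" "g p \<le> 0" "q \<in> S" "0 \<le> g q" by (auto simp: not_less)
  have "0 \<in> g ` S"
    using connectedD_interval[OF connected_continuous_image[OF assms(2,1)], of "g p" "g q" 0] pq by auto
  with assms(3) show False by auto
qed

locale transversal_map =
  fixes f fx fy :: "real \<times> real \<Rightarrow> real" and A1 B1 A2 B2 :: real
  assumes der: "\<And>p. (f has_derivative (\<lambda>v. fx p * fst v + fy p * snd v)) (at p)"
    and cont_fx: "continuous_on UNIV fx" and cont_fy: "continuous_on UNIV fy"
    and fx_nz: "\<And>p. p \<in> {A1..B1} \<times> {A2..B2} \<Longrightarrow> fx p \<noteq> 0"
    and fy_nz: "\<And>p. p \<in> {A1..B1} \<times> {A2..B2} \<Longrightarrow> fy p \<noteq> 0"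
begin

abbreviation D :: "(real \<times> real) set" where "D \<equiv> {A1..B1} \<times> {A2..B2}"

lemma cont_f: "continuous_on S f"
  using der by (meson has_derivative_continuous continuous_at_imp_continuous_on)

lemma convex_D: "convex D"
  by (intro convex_Times) auto

lemma sign_fx: "(\<forall>p\<in>D. fx p > 0) \<or> (\<forall>p\<in>D. fx p < 0)"
  by (rule nonvanishing_constant_sign[OF convex_connected[OF convex_D]])
    (use fx_nz continuous_on_subset[OF cont_fx] in blast)+

lemma sign_fy: "(\<forall>p\<in>D. fy p > 0) \<or> (\<forall>p\<in>D. fy p < 0)"
  by (rule nonvanishing_constant_sign[OF convex_connected[OF convex_D]])
    (use fy_nz continuous_on_subset[OF cont_fy] in blast)+

lemma mean_value:
  assumes "(x, y) \<in> D" "(x', y') \<in> D"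
  obtains z where "z \<in> D" "f (x', y') - f (x, y) = fx z * (x' - x) + fy z * (y' - y)"
proof -
  define p q where "p = (x, y)" and "q = (x', y')"
  define \<gamma> where "\<gamma> u = p + u *\<^sub>R (q - p)" for u :: real
  have "((\<lambda>u. f (\<gamma> u)) has_derivative
      (\<lambda>h. fx (\<gamma> u) * fst (h *\<^sub>R (q - p)) + fy (\<gamma> u) * snd (h *\<^sub>R (q - p)))) (at u within {0..1})" for u
  proof (rule has_derivative_compose[OF _ der])
    show "(\<gamma> has_derivative (\<lambda>h. h *\<^sub>R (q - p))) (at u within {0..1})"
      unfolding \<gamma>_def by (auto intro!: derivative_eq_intros)
  qed
  then obtain u where u: "u \<in> {0<..<1}" "f (\<gamma> 1) - f (\<gamma> 0) =
      fx (\<gamma> u) * fst ((1 - 0) *\<^sub>R (q - p)) + fy (\<gamma> u) * snd ((1 - 0) *\<^sub>R (q - p))"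
    using mvt_simple[of 0 1 "\<lambda>u. f (\<gamma> u)"
        "\<lambda>u h. fx (\<gamma> u) * fst (h *\<^sub>R (q - p)) + fy (\<gamma> u) * snd (h *\<^sub>R (q - p))"] by auto
  have "\<gamma> u = (1 - u) *\<^sub>R p + u *\<^sub>R q" by (simp add: \<gamma>_def algebra_simps)
  then have "\<gamma> u \<in> D" using convexD_alt[OF convex_D assms, of u] u(1) by (simp add: p_def q_def)
  moreover have "f (x', y') - f (x, y) = fx (\<gamma> u) * (x' - x) + fy (\<gamma> u) * (y' - y)"
    using u(2) by (simp add: \<gamma>_def[of 0] \<gamma>_def[of 1] p_def q_def)
  ultimately show thesis by (rule that)
qed

text \<open>
  The image of each vertical side is an interval. The width condition makes the increments of \<open>f\<close> along
  the two diagonals have the weak sign of \<open>\<plusminus> f\<^sub>y\<close>, hence opposite signs; so the difference of the values on the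
  two sides vanishes somewhere, and the two intervals have a common point. Their union is then an interval,
  and it contains the value at any point of the strip because \<open>f\<close> is monotone on horizontal segments.
\<close>

lemma vertical_sides_cover_strip:
  assumes sub: "{l..r} \<subseteq> {A1..B1}" "{c..d} \<subseteq> {A2..B2}" and "l < r" "c \<le> d"
    and wide: "\<And>p. p \<in> D \<Longrightarrow> \<bar>fx p\<bar> * (r - l) \<le> \<bar>fy p\<bar> * (d - c)"
  shows "f ` ({l..r} \<times> {c..d}) \<subseteq> f ` ({l, r} \<times> {c..d})"
proof -
  let ?J = "{c..d}"
  let ?P = "f ` ({l} \<times> ?J)" and ?Q = "f ` ({r} \<times> ?J)"
  have inD: "(x, y) \<in> D" if "x \<in> {l..r}" "y \<in> ?J" for x y using that sub by blast
  have conn: "connected ?P" "connected ?Q"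
    by (intro connected_continuous_image cont_f connected_Times; simp)+
  have meet: "?P \<inter> ?Q \<noteq> {}"
  proof -
    define g where "g = (\<lambda>p. f (r, snd p) - f (l, fst p))"
    have "continuous_on (?J \<times> ?J) g"
      unfolding g_def by (intro continuous_intros continuous_on_compose2[OF cont_f[of UNIV]]) auto
    moreover have "connected (?J \<times> ?J)" by (intro connected_Times) auto
    ultimately have cg: "connected (g ` (?J \<times> ?J))" by (intro connected_continuous_image)
    have corners: "(l, c) \<in> D" "(l, d) \<in> D" "(r, c) \<in> D" "(r, d) \<in> D"
      using \<open>l < r\<close> \<open>c \<le> d\<close> by (intro inD; simp)+
    obtain z where z: "z \<in> D" "g (c, d) = fx z * (r - l) + fy z * (d - c)"
      by (rule mean_value[of l c r d]) (use corners in \<open>simp_all add: g_def\<close>)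
    obtain z' where z': "z' \<in> D" "g (d, c) = fx z' * (r - l) + fy z' * (c - d)"
      by (rule mean_value[of l d r c]) (use corners in \<open>simp_all add: g_def\<close>)
    have z'_eq: "g (d, c) = fx z' * (r - l) - fy z' * (d - c)"
      using z'(2) by (simp add: algebra_simps)
    have dom: "fx p * (r - l) \<le> \<bar>fy p\<bar> * (d - c) \<and> - (\<bar>fy p\<bar> * (d - c)) \<le> fx p * (r - l)"
      if "p \<in> D" for p
    proof -
      have "\<bar>fx p * (r - l)\<bar> \<le> \<bar>fy p\<bar> * (d - c)"
        using wide[OF that] \<open>l < r\<close> by (simp add: abs_mult)
      then show ?thesis by linarith
    qed
    have "g (c, d) \<ge> 0 \<and> g (d, c) \<le> 0 \<or> g (c, d) \<le> 0 \<and> g (d, c) \<ge> 0"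
      using sign_fy
    proof
      assume "\<forall>p\<in>D. fy p > 0"
      with z(1) z'(1) have abs: "\<bar>fy z\<bar> = fy z" "\<bar>fy z'\<bar> = fy z'" by (metis abs_of_pos)+
      have "- (fy z * (d - c)) \<le> fx z * (r - l)" "fx z' * (r - l) \<le> fy z' * (d - c)"
        using dom[OF z(1)] dom[OF z'(1)] unfolding abs by auto
      then show ?thesis unfolding z(2) z'_eq by linarith
    next
      assume "\<forall>p\<in>D. fy p < 0"
      with z(1) z'(1) have abs: "\<bar>fy z\<bar> = - fy z" "\<bar>fy z'\<bar> = - fy z'" by (metis abs_of_neg)+
      have "fx z * (r - l) \<le> - fy z * (d - c)" "- (- fy z' * (d - c)) \<le> fx z' * (r - l)"
        using dom[OF z(1)] dom[OF z'(1)] unfolding abs by auto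
      then show ?thesis unfolding z(2) z'_eq by (simp add: algebra_simps)
    qed
    moreover have "g (c, d) \<in> g ` (?J \<times> ?J)" "g (d, c) \<in> g ` (?J \<times> ?J)"
      using \<open>c \<le> d\<close> by auto
    ultimately have "0 \<in> g ` (?J \<times> ?J)" using connectedD_interval[OF cg] by blast
    then obtain y y' where "y \<in> ?J" "y' \<in> ?J" "f (l, y) = f (r, y')" by (auto simp: g_def)
    then show ?thesis by blast
  qed
  have connPQ: "connected (?P \<union> ?Q)" using connected_Un[OF conn meet] .
  show ?thesis
  proof (rule image_subsetI)
    fix p assume "p \<in> {l..r} \<times> ?J"
    then obtain x y where p: "p = (x, y)" and x: "x \<in> {l..r}" and y: "y \<in> ?J" by blast
    obtain z where z: "z \<in> D" "f (x, y) - f (l, y) = fx z * (x - l)"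
      by (rule mean_value[of l y x y]) (use inD[of l y] inD[of x y] x y \<open>l < r\<close> in \<open>auto\<close>)
    obtain z' where z': "z' \<in> D" "f (r, y) - f (x, y) = fx z' * (r - x)"
      by (rule mean_value[of x y r y]) (use inD[of r y] inD[of x y] x y \<open>l < r\<close> in \<open>auto\<close>)
    have "f (l, y) \<le> f (x, y) \<and> f (x, y) \<le> f (r, y) \<or> f (r, y) \<le> f (x, y) \<and> f (x, y) \<le> f (l, y)"
      using sign_fx
    proof
      assume "\<forall>p\<in>D. fx p > 0"
      then have "0 \<le> fx z * (x - l)" "0 \<le> fx z' * (r - x)"
        using z(1) z'(1) x by (auto intro!: mult_nonneg_nonneg simp: less_imp_le)
      with z(2) z'(2) show ?thesis by linarith
    next
      assume "\<forall>p\<in>D. fx p < 0"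
      then have "fx z * (x - l) \<le> 0" "fx z' * (r - x) \<le> 0"
        using z(1) z'(1) x by (auto intro!: mult_nonpos_nonneg simp: less_imp_le)
      with z(2) z'(2) show ?thesis by linarith
    qed
    moreover have "f (l, y) \<in> ?P \<union> ?Q" "f (r, y) \<in> ?P \<union> ?Q" using y by blast+
    ultimately have "f (x, y) \<in> ?P \<union> ?Q" using connectedD_interval[OF connPQ] by blast
    then show "f p \<in> f ` ({l, r} \<times> ?J)" using p by blast
  qed
qed

lemma image_rectangle_nondegenerate:
  assumes "{a..b} \<subseteq> {A1..B1}" "{c..d} \<subseteq> {A2..B2}" "a < b" "c < d"
  shows "connected (f ` ({a..b} \<times> {c..d}))"
    "\<exists>u v. u \<in> f ` ({a..b} \<times> {c..d}) \<and> v \<in> f ` ({a..b} \<times> {c..d}) \<and> u \<noteq> v"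
proof -
  show "connected (f ` ({a..b} \<times> {c..d}))"
    by (intro connected_continuous_image cont_f connected_Times) auto
  have "(a, c) \<in> D" "(b, c) \<in> D" using assms by auto
  then obtain z where "z \<in> D" "f (b, c) - f (a, c) = fx z * (b - a)"
    by (rule mean_value) auto
  then have "f (b, c) \<noteq> f (a, c)" using fx_nz[of z] \<open>a < b\<close> by auto
  moreover have "f (b, c) \<in> f ` ({a..b} \<times> {c..d})" "f (a, c) \<in> f ` ({a..b} \<times> {c..d})"
    using assms by auto
  ultimately show "\<exists>u v. u \<in> f ` ({a..b} \<times> {c..d}) \<and> v \<in> f ` ({a..b} \<times> {c..d}) \<and> u \<noteq> v" by blast
qed

lemma transversal_map_swap:
  "transversal_map (f \<circ> prod.swap) (fy \<circ> prod.swap) (fx \<circ> prod.swap) A2 B2 A1 B1"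
proof
  fix p :: "real \<times> real"
  have "(prod.swap has_derivative prod.swap) (at p)"
    unfolding prod.swap_def by (auto intro!: derivative_eq_intros)
  from has_derivative_compose[OF this der]
  show "(f \<circ> prod.swap has_derivative
      (\<lambda>v. (fy \<circ> prod.swap) p * fst v + (fx \<circ> prod.swap) p * snd v)) (at p)"
    by (simp add: o_def add.commute)
next
  have swap: "continuous_on UNIV (prod.swap :: real \<times> real \<Rightarrow> real \<times> real)"
    unfolding prod.swap_def by (intro continuous_intros)
  show "continuous_on UNIV (fy \<circ> prod.swap)" "continuous_on UNIV (fx \<circ> prod.swap)"
    by (intro continuous_on_compose[OF swap] continuous_on_subset[OF cont_fy]
        continuous_on_subset[OF cont_fx]; simp)+
next
  fix p assume "p \<in> {A2..B2} \<times> {A1..B1}"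
  then have "prod.swap p \<in> D" by (auto simp: prod.swap_def)
  then show "(fy \<circ> prod.swap) p \<noteq> 0" "(fx \<circ> prod.swap) p \<noteq> 0"
    unfolding o_apply by (rule fy_nz, rule fx_nz)
qed

end

lemma C1_function_has_partials:
  assumes "C1_function f"
  shows "\<And>p. (f has_derivative (\<lambda>v. partial_x f p * fst v + partial_y f p * snd v)) (at p)"
    and "continuous_on UNIV (partial_x f)" and "continuous_on UNIV (partial_y f)"
proof -
  obtain f' :: "real \<times> real \<Rightarrow> (real \<times> real) \<Rightarrow>\<^sub>L real"
    where der: "\<And>p. (f has_derivative blinfun_apply (f' p)) (at p)" and cont: "continuous_on UNIV f'"
    using assms by (auto simp: C1_function_def)
  have hv: "f' p (h, k) = f' p (1, 0) * h + f' p (0, 1) * k" for p h k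
  proof -
    have "(h, k) = h *\<^sub>R (1, 0) + k *\<^sub>R (0, 1)" by simp
    then have "f' p (h, k) = f' p (h *\<^sub>R (1, 0)) + f' p (k *\<^sub>R (0, 1))"
      by (metis blinfun.add_right)
    then show ?thesis by (simp only: blinfun.scaleR_right) simp
  qed
  have hx: "f' p (h, 0) = f' p (1, 0) * h" for p h using hv[of p h 0] by simp
  have hy: "f' p (0, k) = f' p (0, 1) * k" for p k using hv[of p 0 k] by simp
  have px: "partial_x f p = f' p (1, 0)" for p
  proof -
    have g: "((\<lambda>x. (x, snd p)) has_derivative (\<lambda>h. (h, 0))) (at (fst p))"
      by (auto intro!: derivative_eq_intros)
    have "((\<lambda>x. f (x, snd p)) has_derivative (\<lambda>h. f' p (h, 0))) (at (fst p))"
      using has_derivative_compose[OF g, of f "f' p"] der[of p] by simp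
    then have "((\<lambda>x. f (x, snd p)) has_field_derivative f' p (1, 0)) (at (fst p))"
      unfolding has_field_derivative_def by (rule has_derivative_eq_rhs) (rule ext, rule hx)
    then show ?thesis unfolding partial_x_def by (rule DERIV_imp_deriv)
  qed
  have py: "partial_y f p = f' p (0, 1)" for p
  proof -
    have g: "((\<lambda>y. (fst p, y)) has_derivative (\<lambda>k. (0, k))) (at (snd p))"
      by (auto intro!: derivative_eq_intros)
    have "((\<lambda>y. f (fst p, y)) has_derivative (\<lambda>k. f' p (0, k))) (at (snd p))"
      using has_derivative_compose[OF g, of f "f' p"] der[of p] by simp
    then have "((\<lambda>y. f (fst p, y)) has_field_derivative f' p (0, 1)) (at (snd p))"
      unfolding has_field_derivative_def by (rule has_derivative_eq_rhs) (rule ext, rule hy)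
    then show ?thesis unfolding partial_y_def by (rule DERIV_imp_deriv)
  qed
  show "(f has_derivative (\<lambda>v. partial_x f p * fst v + partial_y f p * snd v)) (at p)" for p
    using der[of p] by (rule has_derivative_eq_rhs) (rule ext, unfold px py hv[symmetric], simp)
  show "continuous_on UNIV (partial_x f)" "continuous_on UNIV (partial_y f)"
    unfolding px[abs_def] py[abs_def] by (intro continuous_intros cont)+
qed

section \<open>Images of products of thick sets\<close>

text \<open>
  Each component contains every member of the family that it meets, so a choice of one such member for
  each component is injective.
\<close>

lemma components_of_union_of_connected_sets:
  assumes "finite F" "\<And>T. T \<in> F \<Longrightarrow> connected T" "\<And>T. T \<in> F \<Longrightarrow> T \<noteq> {}"
  shows "finite (components (\<Union>F)) \<and> card (components (\<Union>F)) \<le> card F \<and>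
    (\<forall>C\<in>components (\<Union>F). \<exists>T\<in>F. T \<subseteq> C)"
proof -
  have "\<exists>T\<in>F. T \<subseteq> C" if C: "C \<in> components (\<Union>F)" for C
  proof -
    obtain x T where "x \<in> C" "T \<in> F" "x \<in> T"
      using in_components_nonempty[OF C] in_components_subset[OF C] by blast
    then have "T \<subseteq> C" using components_maximal[OF C assms(2)[of T]] by blast
    with \<open>T \<in> F\<close> show ?thesis by blast
  qed
  then obtain g where g: "\<And>C. C \<in> components (\<Union>F) \<Longrightarrow> g C \<in> F \<and> g C \<subseteq> C" by metis
  have inj: "inj_on g (components (\<Union>F))"
  proof (rule inj_onI)
    fix C E assume C: "C \<in> components (\<Union>F)" and E: "E \<in> components (\<Union>F)" and eq: "g C = g E"
    have "g C \<subseteq> C" "g C \<subseteq> E" "g C \<noteq> {}" using g[OF C] g[OF E] eq assms(3) by auto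
    then show "C = E" using components_nonoverlap[OF C E] by blast
  qed
  have "g ` components (\<Union>F) \<subseteq> F" using g by blast
  then show ?thesis
    using card_inj_on_le[OF inj _ assms(1)] inj_on_finite[OF inj _ assms(1)] g by blast
qed

text \<open>
  Both inequalities between the partial derivatives are stated without quotients, with the bound \<open>s\<close>
  for \<open>\<bar>f\<^sub>x / f\<^sub>y\<bar>\<close> and the bound \<open>s'\<close> for \<open>\<bar>f\<^sub>y / f\<^sub>x\<bar>\<close>. This makes the assumptions symmetric under
  exchange of the two coordinates, so each fact about a gap of the first set yields one for the second.
\<close>

locale gap_removal =
  K1: thick_gap_sequence K1 G A1 B1 t1 + K2: thick_gap_sequence K2 H A2 B2 t2 +
  transversal_map f fx fy A1 B1 A2 B2
  for K1 G A1 B1 t1 K2 H A2 B2 t2 f fx fy +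
  fixes s s' :: real
  assumes s_pos: "s > 0" and s'_pos: "s' > 0"
    and s_le_t2: "s \<le> t2" and s'_le_t1: "s' \<le> t1"
    and fx_le: "\<And>p. p \<in> {A1..B1} \<times> {A2..B2} \<Longrightarrow> \<bar>fx p\<bar> \<le> s * \<bar>fy p\<bar>"
    and fy_le: "\<And>p. p \<in> {A1..B1} \<times> {A2..B2} \<Longrightarrow> \<bar>fy p\<bar> \<le> s' * \<bar>fx p\<bar>"
begin

lemma gap_removal_swap:
  "gap_removal K2 H A2 B2 t2 K1 G A1 B1 t1
     (f \<circ> prod.swap) (fy \<circ> prod.swap) (fx \<circ> prod.swap) s' s"
proof -
  interpret sw: transversal_map "f \<circ> prod.swap" "fy \<circ> prod.swap" "fx \<circ> prod.swap" A2 B2 A1 B1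
    by (rule transversal_map_swap)
  show ?thesis
    by unfold_locales (auto simp: s_pos s'_pos s_le_t2 s'_le_t1 intro!: fx_le fy_le)
qed

lemma image_swap: "(f \<circ> prod.swap) ` (Y \<times> X) = f ` (X \<times> Y)"
  by (simp only: image_comp[symmetric] product_swap)

text \<open>
  Every component of the second factor is long enough for the strip over the removed gap: it is either
  the whole hull, for which this is assumed, or it is at least \<open>t2 \<ge> s\<close> times as long as a gap that is
  no shorter than the one removed.
\<close>

lemma remove_gap_of_first:
  assumes free: "m = 0 \<Longrightarrow> s * len (G n) \<le> B2 - A2"
    and smaller: "m > 0 \<Longrightarrow> len (G n) \<le> len (H (m - 1))"
  shows "f ` (K1.stage (Suc n) \<times> K2.stage m) = f ` (K1.stage n \<times> K2.stage m)"
proof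
  show "f ` (K1.stage (Suc n) \<times> K2.stage m) \<subseteq> f ` (K1.stage n \<times> K2.stage m)"
    using K1.stage_Suc by (intro image_mono) auto
  have long: "s * len (G n) \<le> len E" if E: "E \<in> components (K2.stage m)" for E
  proof (cases m)
    case 0
    with E free K2.hull_nondegenerate show ?thesis by (simp add: K2.components_stage_0)
  next
    case (Suc k)
    have "s * len (G n) \<le> t2 * len (H k)"
      using smaller Suc s_le_t2 s_pos K1.len_gap_positive[of n] by (intro mult_mono) auto
    also have "\<dots> \<le> len E" using K2.component_long E Suc by simp
    finally show ?thesis .
  qed
  obtain l r where lr: "l < r" "G n = {l<..<r}" "l \<in> K1" "r \<in> K1" "{l..r} \<subseteq> K1.stage n"
    by (rule K1.gap_ends)
  show "f ` (K1.stage n \<times> K2.stage m) \<subseteq> f ` (K1.stage (Suc n) \<times> K2.stage m)"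
  proof (rule image_subsetI)
    fix p assume "p \<in> K1.stage n \<times> K2.stage m"
    then obtain x y where p: "p = (x, y)" and x: "x \<in> K1.stage n" and y: "y \<in> K2.stage m" by blast
    show "f p \<in> f ` (K1.stage (Suc n) \<times> K2.stage m)"
    proof (cases "x \<in> G n")
      case False
      with x y p show ?thesis by (auto simp: K1.stage_Suc)
    next
      case True
      define E where "E = connected_component_set (K2.stage m) y"
      have E: "E \<in> components (K2.stage m)" "y \<in> E" using y by (auto simp: E_def componentsI)
      obtain c d where cd: "E = {c..d}" "c \<le> d" using K2.stage_component_interval[OF E(1)] .
      have wide: "\<bar>fx q\<bar> * (r - l) \<le> \<bar>fy q\<bar> * (d - c)" if "q \<in> D" for q
      proof -
        have "\<bar>fx q\<bar> * (r - l) \<le> (s * \<bar>fy q\<bar>) * (r - l)"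
          using fx_le[OF that] lr(1) by (intro mult_right_mono) auto
        also have "\<dots> = \<bar>fy q\<bar> * (s * len (G n))" using lr(1,2) by simp
        also have "\<dots> \<le> \<bar>fy q\<bar> * (d - c)" using long[OF E(1)] cd by (intro mult_left_mono) auto
        finally show ?thesis .
      qed
      have Esub: "E \<subseteq> K2.stage m" using in_components_subset[OF E(1)] .
      have "f p \<in> f ` ({l..r} \<times> {c..d})" using True lr(2) E(2) cd p by auto
      also have "\<dots> \<subseteq> f ` ({l, r} \<times> {c..d})"
      proof (rule vertical_sides_cover_strip[OF _ _ lr(1) cd(2) wide])
        show "{l..r} \<subseteq> {A1..B1}" using lr(5) K1.stage_subset_hull by (rule subset_trans)
        show "{c..d} \<subseteq> {A2..B2}" using Esub K2.stage_subset_hull unfolding cd(1) by (rule subset_trans)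
      qed
      also have "\<dots> \<subseteq> f ` (K1.stage (Suc n) \<times> K2.stage m)"
      proof (intro image_mono Sigma_mono)
        show "{l, r} \<subseteq> K1.stage (Suc n)" using lr(3,4) K1.K_subset_stage by auto
        show "{c..d} \<subseteq> K2.stage m" using Esub cd(1) by simp
      qed
      finally show ?thesis .
    qed
  qed
qed

lemma remove_gap_of_second:
  assumes "n = 0 \<Longrightarrow> s' * len (H m) \<le> B1 - A1"
    and "n > 0 \<Longrightarrow> len (H m) \<le> len (G (n - 1))"
  shows "f ` (K1.stage n \<times> K2.stage (Suc m)) = f ` (K1.stage n \<times> K2.stage m)"
proof -
  interpret sw: gap_removal K2 H A2 B2 t2 K1 G A1 B1 t1
    "f \<circ> prod.swap" "fy \<circ> prod.swap" "fx \<circ> prod.swap" s' s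
    by (rule gap_removal_swap)
  show ?thesis using sw.remove_gap_of_first[OF assms] by (simp only: image_swap)
qed

text \<open>
  The order of removal by length, across both sets: a gap still present in one set is no longer than any
  gap already removed from the other.
\<close>

definition balanced :: "nat \<Rightarrow> nat \<Rightarrow> bool" where
  "balanced n m \<longleftrightarrow>
     (n > 0 \<longrightarrow> len (H m) \<le> len (G (n - 1))) \<and> (m > 0 \<longrightarrow> len (G n) \<le> len (H (m - 1)))"

text \<open>
  Removal of the longer of the two next gaps preserves balance. Balance makes that removal harmless as
  soon as some gap is gone from the other set; before, the assumed bounds by the lengths of the hulls do.
\<close>

lemma image_stages_unchanged:
  assumes "balanced h v"
    and "\<And>n. h \<le> n \<Longrightarrow> s * len (G n) \<le> B2 - A2"
    and "\<And>m. v \<le> m \<Longrightarrow> s' * len (H m) \<le> B1 - A1"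
  shows "\<exists>n m. h \<le> n \<and> v \<le> m \<and> n + m = h + v + k \<and> balanced n m \<and>
    f ` (K1.stage n \<times> K2.stage m) = f ` (K1.stage h \<times> K2.stage v)"
proof (induction k)
  case 0
  show ?case using assms(1) by auto
next
  case (Suc k)
  then obtain n m where nm: "h \<le> n" "v \<le> m" "n + m = h + v + k" "balanced n m"
    "f ` (K1.stage n \<times> K2.stage m) = f ` (K1.stage h \<times> K2.stage v)" by blast
  show ?case
  proof (cases "len (H m) \<le> len (G n)")
    case True
    have "f ` (K1.stage (Suc n) \<times> K2.stage m) = f ` (K1.stage n \<times> K2.stage m)"
      using nm(4) assms(2)[OF nm(1)] by (intro remove_gap_of_first) (auto simp: balanced_def)
    moreover have "balanced (Suc n) m"
      using True nm(4) K1.len_gap_antimono[of n "Suc n"] by (auto simp: balanced_def)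
    ultimately show ?thesis using nm by (intro exI[of _ "Suc n"] exI[of _ m]) auto
  next
    case False
    have "f ` (K1.stage n \<times> K2.stage (Suc m)) = f ` (K1.stage n \<times> K2.stage m)"
      using nm(4) assms(3)[OF nm(2)] by (intro remove_gap_of_second) (auto simp: balanced_def)
    moreover have "balanced n (Suc m)"
      using False nm(4) K2.len_gap_antimono[of m "Suc m"] by (auto simp: balanced_def)
    ultimately show ?thesis using nm by (intro exI[of _ n] exI[of _ "Suc m"]) auto
  qed
qed

text \<open>
  A value of \<open>f\<close> on the initial stages is attained on every later pair of stages reached by the removal,
  hence, by compactness, on their intersection \<open>K1 \<times> K2\<close>. Both indices grow beyond all bounds: if many
  gaps have been removed from one set, the balance forces the gaps still present in the other to be short.
\<close>

lemma image_eq_image_stage: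
  assumes "balanced h v"
    and "\<And>n. h \<le> n \<Longrightarrow> s * len (G n) \<le> B2 - A2"
    and "\<And>m. v \<le> m \<Longrightarrow> s' * len (H m) \<le> B1 - A1"
  shows "f ` (K1 \<times> K2) = f ` (K1.stage h \<times> K2.stage v)"
proof
  show "f ` (K1 \<times> K2) \<subseteq> f ` (K1.stage h \<times> K2.stage v)"
    using K1.K_subset_stage K2.K_subset_stage by (intro image_mono) auto
  show "f ` (K1.stage h \<times> K2.stage v) \<subseteq> f ` (K1 \<times> K2)"
  proof
    fix t assume t: "t \<in> f ` (K1.stage h \<times> K2.stage v)"
    define F where "F N = (K1.stage N \<times> K2.stage N) \<inter> {p. f p = t}" for N
    have "F N \<noteq> {}" for N
    proof -
      obtain M1 where M1: "len (G M1) < min (len (G N)) (len (H N))"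
        using K1.ex_gap_shorter_than[of "min (len (G N)) (len (H N))"]
          K1.len_gap_positive K2.len_gap_positive by auto
      obtain M2 where M2: "len (H M2) < min (len (G N)) (len (H N))"
        using K2.ex_gap_shorter_than[of "min (len (G N)) (len (H N))"]
          K1.len_gap_positive K2.len_gap_positive by auto
      \<comment> \<open>After so many steps more than \<open>M1\<close> gaps are gone from the first set or more than \<open>M2\<close> from the second.\<close>
      obtain n m where nm: "n + m = h + v + (M1 + M2 + 1)" "balanced n m"
        "f ` (K1.stage n \<times> K2.stage m) = f ` (K1.stage h \<times> K2.stage v)"
        using image_stages_unchanged[OF assms, of "M1 + M2 + 1"] by blast
      \<comment> \<open>Antitonicity of the two length sequences turns the comparison of lengths into one of indices.\<close>
      have idx: "N \<le> i" if "len (G i) < len (G N)" for i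
        using that K1.len_gap_antimono[of i N] by (cases "i \<le> N") auto
      have idx': "N \<le> i" if "len (H i) < len (H N)" for i
        using that K2.len_gap_antimono[of i N] by (cases "i \<le> N") auto
      have "N \<le> n \<and> N \<le> m"
      proof (cases "M1 < n")
        case True
        have "len (H m) \<le> len (G (n - 1))" using nm(2) True by (auto simp: balanced_def)
        also have "\<dots> \<le> len (G M1)" using True by (intro K1.len_gap_antimono) auto
        finally show ?thesis using idx[of M1] idx'[of m] M1 True by auto
      next
        case False
        then have m: "M2 < m" using nm(1) by auto
        have "len (G n) \<le> len (H (m - 1))" using nm(2) m by (auto simp: balanced_def)
        also have "\<dots> \<le> len (H M2)" using m by (intro K2.len_gap_antimono) auto
        finally show ?thesis using idx'[of M2] idx[of n] M2 m by auto
      qed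
      then have "K1.stage n \<subseteq> K1.stage N" "K2.stage m \<subseteq> K2.stage N"
        using K1.stage_antimono K2.stage_antimono by auto
      moreover have "t \<in> f ` (K1.stage n \<times> K2.stage m)" using t nm(3) by simp
      then obtain x y where "x \<in> K1.stage n" "y \<in> K2.stage m" "f (x, y) = t" by blast
      ultimately show ?thesis by (auto simp: F_def)
    qed
    moreover have "compact (F N)" for N
    proof -
      have "closed {p. f p = t}" by (intro closed_Collect_eq cont_f continuous_intros)
      then show ?thesis
        unfolding F_def by (intro compact_Int_closed compact_Times K1.compact_stage K2.compact_stage)
    qed
    moreover have "F N \<subseteq> F M" if "M \<le> N" for M N
      using K1.stage_antimono[OF that] K2.stage_antimono[OF that] by (auto simp: F_def)
    ultimately have "(\<Inter>N. F N) \<noteq> {}" by (intro compact_nest) auto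
    then obtain x y where "\<And>N. (x, y) \<in> F N" by fastforce
    then have "x \<in> (\<Inter>N. K1.stage N)" "y \<in> (\<Inter>N. K2.stage N)" "f (x, y) = t"
      by (auto simp: F_def)
    then show "t \<in> f ` (K1 \<times> K2)" using K1.Inter_stage K2.Inter_stage by auto
  qed
qed

text \<open>
  The hull of the second set contains a longest gap together with its two bridges, so it is at least
  \<open>2 * t2 + 1\<close> times as long as that gap, while it is at most \<open>s \<le> t2\<close> times the oversized gap.
\<close>

lemma oversized_gap_dominates:
  assumes "(B2 - A2) / s \<le> len (G n)"
  shows "len (H m) < len (G n)"
proof -
  have "s * len (H m) \<le> t2 * len (H 0)"
    using s_le_t2 s_pos K2.len_gap_antimono[of 0 m] K2.len_gap_positive[of m] by (intro mult_mono) auto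
  also have "\<dots> < (2 * t2 + 1) * len (H 0)"
    using K2.len_gap_positive[of 0] K2.t_pos by simp
  also have "\<dots> \<le> B2 - A2" by (rule K2.hull_longer_than_gap_and_bridges)
  also have "\<dots> \<le> s * len (G n)" using assms s_pos by (simp add: pos_divide_le_eq mult.commute)
  finally show ?thesis using s_pos by simp
qed

text \<open>
  The stages \<open>h\<close> and \<open>v\<close> are those after removal of all oversized gaps. Since \<open>h\<close> or \<open>v\<close> is zero,
  they have \<open>h + v + 1\<close> pairs of components at most, and each pair has a nondegenerate interval as its image.
  These intervals may overlap; the components of their union are disjoint and not more numerous.
\<close>

theorem image_union_of_intervals:
  fixes h v :: nat
  defines "h \<equiv> card {U \<in> gaps K1. (B2 - A2) / s \<le> len U}"
    and "v \<equiv> card {U \<in> gaps K2. (B1 - A1) / s' \<le> len U}"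
  shows "\<exists>\<J> :: real set set. finite \<J> \<and> (\<forall>J\<in>\<J>. \<exists>a b. a < b \<and> J = {a..b}) \<and> disjoint \<J> \<and>
    f ` (K1 \<times> K2) = \<Union>\<J> \<and> card \<J> \<le> h + v + 1"
proof -
  interpret sw: gap_removal K2 H A2 B2 t2 K1 G A1 B1 t1
    "f \<circ> prod.swap" "fy \<circ> prod.swap" "fx \<circ> prod.swap" s' s
    by (rule gap_removal_swap)
  have h: "(B2 - A2) / s \<le> len (G n) \<longleftrightarrow> n < h" for n
    unfolding h_def using K2.hull_nondegenerate s_pos by (intro K1.large_gap_iff_index) simp
  have v: "(B1 - A1) / s' \<le> len (H m) \<longleftrightarrow> m < v" for m
    unfolding v_def using K1.hull_nondegenerate s'_pos by (intro K2.large_gap_iff_index) simp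
  have domG: "len (H m) < len (G n)" if "n < h" for n m
    using oversized_gap_dominates h that by blast
  have domH: "len (G n) < len (H m)" if "m < v" for n m
    using sw.oversized_gap_dominates v that by blast
  have zero: "h = 0 \<or> v = 0" using domG[of 0 0] domH[of 0 0] by force
  have "balanced h v"
    unfolding balanced_def using domG[of "h - 1" v] domH[of "v - 1" h] by force
  moreover have "s * len (G n) \<le> B2 - A2" if "h \<le> n" for n
    using h[of n] that s_pos by (simp add: not_le not_less pos_less_divide_eq mult.commute)
  moreover have "s' * len (H m) \<le> B1 - A1" if "v \<le> m" for m
    using v[of m] that s'_pos by (simp add: not_le not_less pos_less_divide_eq mult.commute)
  ultimately have im: "f ` (K1 \<times> K2) = f ` (K1.stage h \<times> K2.stage v)"
    by (rule image_eq_image_stage)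
  define C where "C = components (K1.stage h) \<times> components (K2.stage v)"
  define F where "F = (\<lambda>(I, J). f ` (I \<times> J)) ` C"
  have fin: "finite C" using K1.card_components_stage K2.card_components_stage by (simp add: C_def)
  have "card F \<le> card C" unfolding F_def by (rule card_image_le[OF fin])
  also have "\<dots> \<le> (h + 1) * (v + 1)"
    unfolding C_def card_cartesian_product
    using K1.card_components_stage K2.card_components_stage by (intro mult_mono) auto
  also have "\<dots> = h + v + 1" using zero by auto
  finally have cardF: "card F \<le> h + v + 1" .
  have UF: "\<Union>F = f ` (K1.stage h \<times> K2.stage v)"
  proof -
    have "\<Union>F = f ` (\<Union>(I, J)\<in>C. I \<times> J)" unfolding F_def by blast
    also have "(\<Union>(I, J)\<in>C. I \<times> J) = \<Union>(components (K1.stage h)) \<times> \<Union>(components (K2.stage v))"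
      unfolding C_def by blast
    finally show ?thesis by simp
  qed
  have T: "connected T \<and> (\<exists>u w. u \<in> T \<and> w \<in> T \<and> u \<noteq> w)" if TF: "T \<in> F" for T
  proof -
    obtain I J where IJ: "I \<in> components (K1.stage h)" "J \<in> components (K2.stage v)" "T = f ` (I \<times> J)"
      using TF unfolding F_def C_def by blast
    obtain a b where ab: "I = {a..b}" "a < b" using K1.component_nondegenerate[OF IJ(1)] .
    obtain c d where cd: "J = {c..d}" "c < d" using K2.component_nondegenerate[OF IJ(2)] .
    have "{a..b} \<subseteq> {A1..B1}" "{c..d} \<subseteq> {A2..B2}"
      using in_components_subset[OF IJ(1)] in_components_subset[OF IJ(2)]
        K1.stage_subset_hull K2.stage_subset_hull unfolding ab(1) cd(1) by blast+
    from image_rectangle_nondegenerate[OF this ab(2) cd(2)] show ?thesis unfolding IJ(3) ab(1) cd(1) by blast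
  qed
  have finF: "finite F" using fin by (simp add: F_def)
  have comps: "finite (components (\<Union>F)) \<and> card (components (\<Union>F)) \<le> card F \<and>
      (\<forall>E\<in>components (\<Union>F). \<exists>T\<in>F. T \<subseteq> E)"
    by (rule components_of_union_of_connected_sets[OF finF]) (use T in blast)+
  have compUF: "compact (\<Union>F)"
    unfolding UF
    by (intro compact_continuous_image cont_f compact_Times K1.compact_stage K2.compact_stage)
  have "\<exists>a b. a < b \<and> E = {a..b}" if E: "E \<in> components (\<Union>F)" for E
  proof -
    have "compact E" "connected E"
      using compact_components[OF compUF E] in_components_connected[OF E] by auto
    then obtain a b where "E = {a..b}" using connected_compact_interval_1 by blast
    moreover obtain u w where "u \<in> E" "w \<in> E" "u \<noteq> w" using comps E T by (meson subsetD)
    ultimately have "a < b" by auto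
    with \<open>E = {a..b}\<close> show ?thesis by blast
  qed
  moreover have "disjoint (components (\<Union>F))"
    using pairwise_disjoint_components[of "\<Union>F"] by (simp add: disjoint_def pairwise_def disjnt_def)
  ultimately show ?thesis
    using comps cardF im UF Union_components[of "\<Union>F"] by (intro exI[of _ "components (\<Union>F)"]) auto
qed

end

section \<open>The image of a product of Cantor sets\<close>

text \<open>
  The supremum and the infimum of the ratio are finite and positive because the hypotheses squeeze it
  between \<open>1 / \<tau>(K1)\<close> and \<open>\<tau>(K2)\<close>. For the same reason the thicknesses are positive, as required
  of the constants \<open>t1\<close> and \<open>t2\<close> in the locale.
\<close>

theorem theorem1p14:
  fixes f :: "real \<times> real \<Rightarrow> real"
    and K1 K2 :: "real set"
    and A1 B1 A2 B2 :: real
    and D :: "(real \<times> real) set"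
    and h1 v1 :: nat
  assumes "C1_function f"
    and "cantor_set K1" and "cantor_set K2"
    and "convex hull K1 = {A1..B1}" and "convex hull K2 = {A2..B2}"
    and "D = {A1..B1} \<times> {A2..B2}"
    and "\<And>p. p \<in> D \<Longrightarrow> \<bar>partial_x f p\<bar> > 0"
    and "\<And>p. p \<in> D \<Longrightarrow> \<bar>partial_y f p\<bar> > 0"
    and "\<And>p. p \<in> D \<Longrightarrow> 1 / thickness K1 \<le> ereal \<bar>partial_x f p / partial_y f p\<bar>"
    and "\<And>p. p \<in> D \<Longrightarrow> ereal \<bar>partial_x f p / partial_y f p\<bar> \<le> thickness K2"
    and "h1 = card {U \<in> gaps K1. (B2 - A2) / len U \<le> (SUP p\<in>D. \<bar>partial_x f p / partial_y f p\<bar>)}"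
    and "v1 = card {U \<in> gaps K2. len U / (B1 - A1) \<ge> (INF p\<in>D. \<bar>partial_x f p / partial_y f p\<bar>)}"
  shows "\<exists>\<J> :: real set set.
           finite \<J> \<and> (\<forall>J\<in>\<J>. \<exists>a b. a < b \<and> J = {a..b}) \<and> disjoint \<J> \<and>
           f ` (K1 \<times> K2) = \<Union>\<J> \<and> card \<J> \<le> h1 + v1 + 1"
proof -
  let ?fx = "partial_x f" and ?fy = "partial_y f"
  define \<rho> where "\<rho> p = \<bar>?fx p / ?fy p\<bar>" for p
  note C1 = C1_function_has_partials[OF assms(1)]
  have nz: "?fx p \<noteq> 0" "?fy p \<noteq> 0" if "p \<in> D" for p
    using assms(7)[OF that] assms(8)[OF that] by auto
  have \<rho>_pos: "\<rho> p > 0" if "p \<in> D" for p using nz[OF that] by (simp add: \<rho>_def)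
  have "K1 \<noteq> {}" "K2 \<noteq> {}" using assms(2,3) by (auto simp: cantor_set_def)
  then have "{A1..B1} \<noteq> {}" "{A2..B2} \<noteq> {}" using assms(4,5) by force+
  then have neD: "D \<noteq> {}" unfolding assms(6) by blast
  then obtain p0 where p0: "p0 \<in> D" by blast
  obtain G t1 where t1: "thickness K1 = ereal t1" "0 \<le> t1" and G: "gap_enumeration K1 G"
    "\<forall>n. t1 * len (G n) \<le> len (left_bridge K1 G n)"
    "\<forall>n. t1 * len (G n) \<le> len (right_bridge K1 G n)"
    by (rule thickness_bounds_bridges[OF assms(2,4)])
  obtain H t2 where t2: "thickness K2 = ereal t2" "0 \<le> t2" and H: "gap_enumeration K2 H"
    "\<forall>n. t2 * len (H n) \<le> len (left_bridge K2 H n)"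
    "\<forall>n. t2 * len (H n) \<le> len (right_bridge K2 H n)"
    by (rule thickness_bounds_bridges[OF assms(3,5)])
  have le_t2: "\<rho> p \<le> t2" if "p \<in> D" for p using assms(10)[OF that] by (simp add: \<rho>_def t2(1))
  have t2_pos: "t2 > 0" using le_t2[OF p0] \<rho>_pos[OF p0] by linarith
  have t1_pos: "t1 > 0"
  proof (rule ccontr)
    assume "\<not> t1 > 0"
    then have "t1 = 0" using t1(2) by simp
    \<comment> \<open>In the extended reals a positive number divided by zero is infinite.\<close>
    then have "1 / thickness K1 = \<infinity>" using t1(1) by (simp add: zero_ereal_def[symmetric] divide_ereal_def)
    then show False using assms(9)[OF p0] by (simp only: ereal_infty_less_eq(1)) simp
  qed
  have ge_t1: "1 / t1 \<le> \<rho> p" if "p \<in> D" for p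
    using assms(9)[OF that] t1_pos by (simp add: \<rho>_def t1(1) one_ereal_def)
  define s where "s = (SUP p\<in>D. \<rho> p)"
  define i where "i = (INF p\<in>D. \<rho> p)"
  have le_s: "\<rho> p \<le> s" if "p \<in> D" for p
    unfolding s_def by (rule cSUP_upper[OF that bdd_aboveI2[OF le_t2]])
  have ge_i: "i \<le> \<rho> p" if "p \<in> D" for p
    unfolding i_def by (rule cINF_lower[OF bdd_belowI2[OF ge_t1] that])
  have s_le: "s \<le> t2" unfolding s_def by (rule cSUP_least[OF neD le_t2])
  have i_ge: "1 / t1 \<le> i" unfolding i_def by (rule cINF_greatest[OF neD ge_t1])
  have s_pos: "s > 0" using le_s[OF p0] \<rho>_pos[OF p0] by linarith
  have "0 < 1 / t1" using t1_pos by simp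
  then have i_pos: "i > 0" using i_ge by linarith
  have inv_i_le: "1 / i \<le> t1" using i_ge i_pos t1_pos by (simp add: field_simps)
  interpret gap_removal K1 G A1 B1 t1 K2 H A2 B2 t2 f ?fx ?fy s "1 / i"
  proof unfold_locales
    show "compact K1" "compact K2" using assms(2,3) by (auto simp: cantor_set_def)
    show "t1 * len (G n) \<le> len (left_bridge K1 G n)" "t1 * len (G n) \<le> len (right_bridge K1 G n)" for n
      using G(2,3) by auto
    show "t2 * len (H n) \<le> len (left_bridge K2 H n)" "t2 * len (H n) \<le> len (right_bridge K2 H n)" for n
      using H(2,3) by auto
    fix p assume "p \<in> {A1..B1} \<times> {A2..B2}"
    then have p: "p \<in> D" by (simp add: assms(6))
    show "?fx p \<noteq> 0" "?fy p \<noteq> 0" using nz[OF p] by auto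
    show "\<bar>?fx p\<bar> \<le> s * \<bar>?fy p\<bar>"
      using le_s[OF p] nz[OF p] by (simp add: \<rho>_def abs_divide pos_divide_le_eq)
    show "\<bar>?fy p\<bar> \<le> 1 / i * \<bar>?fx p\<bar>"
      using ge_i[OF p] nz[OF p] i_pos by (simp add: \<rho>_def abs_divide field_simps)
  qed (fact assms(4) assms(5) G(1) H(1) t1_pos t2_pos C1 s_pos s_le inv_i_le
      | use i_pos in simp)+
  have "{U \<in> gaps K1. (B2 - A2) / len U \<le> s} = {U \<in> gaps K1. (B2 - A2) / s \<le> len U}"
    using len_gap_pos[OF K1.closed_K] s_pos by (auto simp: pos_divide_le_eq mult.commute)
  then have h1: "h1 = card {U \<in> gaps K1. (B2 - A2) / s \<le> len U}"
    using assms(11) by (simp add: s_def \<rho>_def)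
  have "{U \<in> gaps K2. len U / (B1 - A1) \<ge> i} = {U \<in> gaps K2. (B1 - A1) / (1 / i) \<le> len U}"
    using K1.hull_nondegenerate by (auto simp: pos_le_divide_eq mult.commute)
  then have v1: "v1 = card {U \<in> gaps K2. (B1 - A1) / (1 / i) \<le> len U}"
    using assms(12) by (simp add: i_def \<rho>_def)
  show ?thesis unfolding h1 v1 by (rule image_union_of_intervals)
qed

end
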